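(* Let $\mathbb{X}$, $a$, $b$, $\mathbb{W}$, $u_{\mathbb{W}}$, $u^{\mathrm{loc}}_{\mathbb{W}}$, $\widetilde u_{\mathbb{W}}$, $\xi_1,\dots,\xi_L$, $\mathbb{Y}$, $u_{\mathbb{Y}}$, $u_{\mathbb{X}}$ be as described in the context, with $\dim\mathbb{Y}=L+1$, and let $\epsilon\in\mathbb{R}$ and $y_{\xi}\in\operatorname{span}\{\xi_1,\dots,\xi_L\}$ be the unique elements with $u_{\mathbb{Y}}=(1+\epsilon)\,\widetilde u_{\mathbb{W}}+y_{\xi}$. Then the predicted error reduction $\Delta e_{\mathbb{W},\mathbb{Y}}^2:=\|u_{\mathbb{X}}-u_{\mathbb{W}}\|_{\mathbb{X}}^2-\|u_{\mathbb{X}}-u_{\mathbb{Y}}\|_{\mathbb{X}}^2$ satisfies $$\Delta e_{\mathbb{W},\mathbb{Y}}^2=\|u_{\mathbb{Y}}-u_{\mathbb{W}}\|_{\mathbb{X}}^2-2\,\rho_{\mathbb{Y}}(u^{\mathrm{loc}}_{\mathbb{W}})=\rho_{\mathbb{W}}(y_{\xi})-\rho_{\mathbb{Y}}(u^{\mathrm{loc}}_{\mathbb{W}}),$$ where $\rho_{\mathbb{W}}(v):=b(v)-a(u_{\mathbb{W}},v)$ and $\rho_{\mathbb{Y}}(v):=b(v)-a(u_{\mathbb{Y}},v)$ for $v\in\mathbb{X}$.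
   Context: $\mathbb{X}$ is a real Hilbert space, $a:\mathbb{X}\times\mathbb{X}\to\mathbb{R}$ is a bounded, symmetric and coercive bilinear form, with induced norm $\|v\|_{\mathbb{X}}:=a(v,v)^{1/2}$, and $b:\mathbb{X}\to\mathbb{R}$ is a bounded linear form. $u_{\mathbb{X}}\in\mathbb{X}$ is the unique solution of $a(u_{\mathbb{X}},v)=b(v)$ for all $v\in\mathbb{X}$. $\mathbb{W}=\operatorname{span}\{\phi_1,\dots,\phi_N\}\subseteq\mathbb{X}$ is a subspace of finite dimension $N\ge 1$ with basis $\phi_1,\dots,\phi_N$, and $u_{\mathbb{W}}\in\mathbb{W}$ is the unique solution of $a(u_{\mathbb{W}},w)=b(w)$ for all $w\in\mathbb{W}$. For an index subset $\mathcal{I}^{\mathrm{loc}}\subset\{1,\dots,N\}$ let $\mathbb{W}^{\mathrm{loc}}:=\operatorname{span}\{\phi_i: i\in\mathcal{I}^{\mathrm{loc}}\}$, and let $\Pi^{\mathrm{loc}}:\mathbb{W}\to\mathbb{W}^{\mathrm{loc}}$ be the linear projection $\sum_{i=1}^N v_i\phi_i\mapsto\sum_{i\in\mathcal{I}^{\mathrm{loc}}}v_i\phi_i$. Set $u^{\mathrm{loc}}_{\mathbb{W}}:=\Pi^{\mathrm{loc}}u_{\mathbb{W}}$ and $\widetilde u_{\mathbb{W}}:=u_{\mathbb{W}}-u^{\mathrm{loc}}_{\mathbb{W}}$. $\xi_1,\dots,\xi_L\in\mathbb{X}$ are linearly independent, and $\mathbb{Y}:=\operatorname{span}\{\widetilde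 u_{\mathbb{W}},\xi_1,\dots,\xi_L\}\subseteq\mathbb{X}$ is assumed to have dimension $L+1$. $u_{\mathbb{Y}}\in\mathbb{Y}$ is the unique solution of $a(u_{\mathbb{Y}},v)=b(v)$ for all $v\in\mathbb{Y}$. *)

theory Defs
  imports "HOL-Analysis.Analysis"
begin

definition symmetric_form :: "('x \<Rightarrow> 'x \<Rightarrow> real) \<Rightarrow> bool" where
  "symmetric_form a \<longleftrightarrow> (\<forall>u v. a u v = a v u)"

definition coercive_form :: "('x::real_normed_vector \<Rightarrow> 'x \<Rightarrow> real) \<Rightarrow> bool" where
  "coercive_form a \<longleftrightarrow> (\<exists>\<alpha>>0. \<forall>v. a v v \<ge> \<alpha> * (norm v)\<^sup>2)"

definition energy_norm :: "('x \<Rightarrow> 'x \<Rightarrow> real) \<Rightarrow> 'x \<Rightarrow> real" where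
  "energy_norm a v = sqrt (a v v)"

definition variational_solution ::
    "('x \<Rightarrow> 'x \<Rightarrow> real) \<Rightarrow> ('x \<Rightarrow> real) \<Rightarrow> 'x set \<Rightarrow> 'x \<Rightarrow> bool" where
  "variational_solution a b V u \<longleftrightarrow> u \<in> V \<and> (\<forall>v\<in>V. a u v = b v)"

definition residual :: "('x \<Rightarrow> 'x \<Rightarrow> real) \<Rightarrow> ('x \<Rightarrow> real) \<Rightarrow> 'x \<Rightarrow> 'x \<Rightarrow> real" where
  "residual a b u v = b v - a u v"

definition error_reduction :: "('x::minus \<Rightarrow> 'x \<Rightarrow> real) \<Rightarrow> 'x \<Rightarrow> 'x \<Rightarrow> 'x \<Rightarrow> real" where
  "error_reduction a uX uW uY = (energy_norm a (uX - uW))\<^sup>2 - (energy_norm a (uX - uY))\<^sup>2"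

text \<open>A family indexed by \<open>{1..n}\<close>; injectivity is needed because \<^const>\<open>independent\<close>
  is a property of the set of values only and does not see repetitions.\<close>

definition independent_family :: "nat \<Rightarrow> (nat \<Rightarrow> 'x::real_vector) \<Rightarrow> bool" where
  "independent_family n f \<longleftrightarrow> inj_on f {1..n} \<and> independent (f ` {1..n})"

text \<open>For an independent family \<open>\<phi>\<close> and \<open>v\<close> in its span, \<open>representation (\<phi> ` {1..N}) v (\<phi> i)\<close>
  is the coefficient \<open>v\<^sub>i\<close> in the expansion of \<open>v\<close>. The projection depends on the whole
  basis and not just on the subspace it maps onto; outside the span its value is \<open>0\<close>.\<close>

definition coord_projection ::
    "nat \<Rightarrow> (nat \<Rightarrow> 'x::real_vector) \<Rightarrow> nat set \<Rightarrow> 'x \<Rightarrow> 'x" where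
  "coord_projection N \<phi> I v = (\<Sum>i\<in>I. representation (\<phi> ` {1..N}) v (\<phi> i) *\<^sub>R \<phi> i)"

lemma coord_projection_sum:
  assumes "independent_family N \<phi>" "I \<subseteq> {1..N}"
  shows "coord_projection N \<phi> I (\<Sum>i\<in>{1..N}. c i *\<^sub>R \<phi> i) = (\<Sum>i\<in>I. c i *\<^sub>R \<phi> i)"
proof -
  have inj: "inj_on \<phi> {1..N}" and ind: "independent (\<phi> ` {1..N})"
    using assms(1) by (auto simp: independent_family_def)
  have "representation (\<phi> ` {1..N}) (\<Sum>i\<in>{1..N}. c i *\<^sub>R \<phi> i) (\<phi> j) = c j" if j: "j \<in> {1..N}" for j
  proof -
    have "representation (\<phi> ` {1..N}) (\<Sum>i\<in>{1..N}. c i *\<^sub>R \<phi> i) (\<phi> j)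
        = (\<Sum>i\<in>{1..N}. representation (\<phi> ` {1..N}) (c i *\<^sub>R \<phi> i) (\<phi> j))"
      by (subst representation_sum[OF ind]) (simp_all add: span_base span_scale del: One_nat_def)
    also have "\<dots> = (\<Sum>i\<in>{1..N}. if i = j then c i else 0)"
    proof (rule sum.cong[OF refl])
      fix i assume i: "i \<in> {1..N}"
      have "representation (\<phi> ` {1..N}) (c i *\<^sub>R \<phi> i) (\<phi> j)
          = c i * (if \<phi> i = \<phi> j then 1 else 0)"
        using i by (simp add: representation_scale[OF ind] span_base representation_basis[OF ind]
            del: One_nat_def)
      then show "representation (\<phi> ` {1..N}) (c i *\<^sub>R \<phi> i) (\<phi> j) = (if i = j then c i else 0)"
        using inj_onD[OF inj _ i j] by auto
    qed
    finally show ?thesis using j by simp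
  qed
  then show ?thesis
    using assms(2) unfolding coord_projection_def by (intro sum.cong) auto
qed

lemma variational_solution_unique:
  fixes a :: "'x::real_normed_vector \<Rightarrow> 'x \<Rightarrow> real"
  assumes "bounded_bilinear a" "coercive_form a" "subspace V"
    and "variational_solution a b V u" "variational_solution a b V u'"
  shows "u = u'"
proof -
  interpret bounded_bilinear a by fact
  obtain \<alpha> where \<alpha>: "\<alpha> > 0" "\<And>v. a v v \<ge> \<alpha> * (norm v)\<^sup>2"
    using assms(2) by (auto simp: coercive_form_def)
  have "u - u' \<in> V"
    using assms(3-5) by (simp add: variational_solution_def subspace_diff)
  then have "a (u - u') (u - u') = 0"
    using assms(4,5) diff_left[of u u' "u - u'"] by (auto simp: variational_solution_def)
  with \<alpha>(2)[of "u - u'"] have "\<alpha> * (norm (u - u'))\<^sup>2 \<le> 0" by simp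
  with \<alpha>(1) show ?thesis by (simp add: mult_le_0_iff)
qed

end

theory Submission
  imports Defs
begin

text \<open>
  Write \<open>d = uY - uW\<close>. Everything is decided by the two numbers \<open>\<rho>\<^sub>W(d)\<close> and \<open>\<rho>\<^sub>Y(d)\<close>, the
  residuals of the two Galerkin solutions in the direction that joins them. The residual is
  affine in the approximant with linear part \<open>- a\<close>, so their difference is the squared distance
  \<open>\<parallel>d\<parallel>\<^sup>2 = \<rho>\<^sub>W(d) - \<rho>\<^sub>Y(d)\<close> (\<open>energy_norm_diff_eq_residuals\<close>). The energy of the error is
  quadratic in the approximant, so its decrease along the segment is the mean of the rates of
  decrease \<open>2 \<rho>\<^sub>W(d)\<close> and \<open>2 \<rho>\<^sub>Y(d)\<close> at the two ends, that is \<open>\<rho>\<^sub>W(d) + \<rho>\<^sub>Y(d)\<close>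
  (\<open>error_reduction_eq_residuals\<close>). Both hold for arbitrary approximants.

  Galerkin orthogonality then says that each residual sees \<open>d\<close> only modulo its own trial space.
  As \<open>uW = utilde + uloc\<close> with \<open>uY\<close> and \<open>utilde\<close> in \<open>Y\<close>, one has \<open>d \<equiv> - uloc\<close> modulo \<open>Y\<close>. As
  \<open>d = y\<^sub>\<xi> + \<epsilon> utilde - uloc\<close> and the local projection does not leave \<open>W\<close>, one has \<open>d \<equiv> y\<^sub>\<xi>\<close>
  modulo \<open>W\<close>. Hence \<open>\<rho>\<^sub>Y(d) = - \<rho>\<^sub>Y(uloc)\<close> and \<open>\<rho>\<^sub>W(d) = \<rho>\<^sub>W(y\<^sub>\<xi>)\<close>, which gives both equalities.
\<close>

lemma energy_norm_squared:
  assumes "coercive_form a"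
  shows "(energy_norm a v)\<^sup>2 = a v v"
proof -
  obtain \<alpha> where "\<alpha> > 0" "a v v \<ge> \<alpha> * (norm v)\<^sup>2"
    using assms by (auto simp: coercive_form_def)
  then have "0 \<le> a v v"
    by (smt (verit) mult_nonneg_nonneg zero_le_power2)
  then show ?thesis
    by (simp add: energy_norm_def)
qed

lemma linear_residual:
  fixes a :: "'x::real_normed_vector \<Rightarrow> 'x \<Rightarrow> real"
  assumes "bounded_bilinear a" "bounded_linear b"
  shows "linear (residual a b u)"
proof -
  have "bounded_linear (\<lambda>v. b v - a u v)"
    by (intro bounded_linear_sub assms(2) bounded_bilinear.bounded_linear_right[OF assms(1)])
  then show ?thesis
    unfolding residual_def by (rule bounded_linear.linear)
qed

lemma residual_eq_modulo_trial_space: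
  fixes a :: "'x::real_normed_vector \<Rightarrow> 'x \<Rightarrow> real"
  assumes "bounded_bilinear a" "bounded_linear b"
    and "variational_solution a b V u" "v - w \<in> V"
  shows "residual a b u v = residual a b u w"
proof -
  have "residual a b u (v - w) = 0"
    using assms(3,4) by (simp add: variational_solution_def residual_def)
  then show ?thesis
    by (simp add: linear_diff[OF linear_residual[OF assms(1,2)]])
qed

lemma energy_norm_diff_eq_residuals:
  fixes a :: "'x::real_normed_vector \<Rightarrow> 'x \<Rightarrow> real"
  assumes "bounded_bilinear a" "coercive_form a"
  shows "(energy_norm a (v - w))\<^sup>2 = residual a b w (v - w) - residual a b v (v - w)"
  by (simp add: energy_norm_squared[OF assms(2)] residual_def
      bounded_bilinear.diff_left[OF assms(1)])

text \<open>With \<open>u\<close> the exact solution, \<open>residual a b w\<close> is \<open>a (u - w)\<close>. So this is the identity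
  \<open>\<parallel>p\<parallel>\<^sup>2 - \<parallel>q\<parallel>\<^sup>2 = a p (p - q) + a q (p - q)\<close> for the two errors \<open>p = u - w\<close> and \<open>q = u - v\<close>,
  whose difference is \<open>v - w\<close>. Symmetry of \<open>a\<close> removes the mixed terms.\<close>

lemma error_reduction_eq_residuals:
  fixes a :: "'x::real_normed_vector \<Rightarrow> 'x \<Rightarrow> real"
  assumes "bounded_bilinear a" "symmetric_form a" "coercive_form a"
    and "variational_solution a b UNIV u"
  shows "error_reduction a u w v = residual a b w (v - w) + residual a b v (v - w)"
proof -
  interpret bounded_bilinear a by fact
  have err: "residual a b z x = a (u - z) x" for z x
    using assms(4) by (simp add: variational_solution_def residual_def diff_left)
  have sym: "a x y = a y x" for x y
    using assms(2) by (simp add: symmetric_form_def)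
  have "error_reduction a u w v = a (u - w) (u - w) - a (u - v) (u - v)"
    by (simp add: error_reduction_def energy_norm_squared[OF assms(3)])
  also have "\<dots> = a (u - w) ((u - w) - (u - v)) + a (u - v) ((u - w) - (u - v))"
    using sym[of "u - w" "u - v"] by (simp only: diff_right)
  finally show ?thesis
    by (simp add: err)
qed

lemma coord_projection_in_span:
  assumes "I \<subseteq> {1..N}"
  shows "coord_projection N \<phi> I v \<in> span (\<phi> ` {1..N})"
  unfolding coord_projection_def
  using assms by (intro span_sum span_scale span_base) auto

theorem proposition1:
  fixes a :: "'x::{real_inner,complete_space} \<Rightarrow> 'x \<Rightarrow> real"
    and b :: "'x \<Rightarrow> real"
    and \<phi> \<xi> :: "nat \<Rightarrow> 'x"
    and N L :: nat
    and Iloc :: "nat set"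
    and W Y :: "'x set"
    and uX uW uloc utilde uY y\<^sub>\<xi> :: 'x
    and \<epsilon> :: real
  assumes "bounded_bilinear a" and "symmetric_form a" and "coercive_form a"
    and "bounded_linear b"
    and "variational_solution a b UNIV uX"
    and "N \<ge> 1" and "independent_family N \<phi>" and "W = span (\<phi> ` {1..N})"
    and "variational_solution a b W uW"
    and "Iloc \<subseteq> {1..N}"
    and "uloc = coord_projection N \<phi> Iloc uW"
    and "utilde = uW - uloc"
    and "independent_family L \<xi>"
    and "Y = span (insert utilde (\<xi> ` {1..L}))" and "dim Y = L + 1"
    and "variational_solution a b Y uY"
    and "y\<^sub>\<xi> \<in> span (\<xi> ` {1..L})" and "uY = (1 + \<epsilon>) *\<^sub>R utilde + y\<^sub>\<xi>"
  shows "error_reduction a uX uW uY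
           = (energy_norm a (uY - uW))\<^sup>2 - 2 * residual a b uY uloc
       \<and> (energy_norm a (uY - uW))\<^sup>2 - 2 * residual a b uY uloc
           = residual a b uW y\<^sub>\<xi> - residual a b uY uloc"
proof -
  note bil = \<open>bounded_bilinear a\<close> and lin = \<open>bounded_linear b\<close>
  let ?d = "uY - uW"
  have uW: "uW \<in> W"
    using \<open>variational_solution a b W uW\<close> by (simp add: variational_solution_def)
  have uloc: "uloc \<in> W"
    unfolding \<open>uloc = coord_projection N \<phi> Iloc uW\<close> \<open>W = span (\<phi> ` {1..N})\<close>
    using \<open>Iloc \<subseteq> {1..N}\<close> by (rule coord_projection_in_span)
  have utilde_W: "utilde \<in> W"
    using uW uloc unfolding \<open>utilde = uW - uloc\<close> \<open>W = span (\<phi> ` {1..N})\<close> by (rule span_diff)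
  have uY: "uY \<in> Y"
    using \<open>variational_solution a b Y uY\<close> by (simp add: variational_solution_def)
  have utilde_Y: "utilde \<in> Y"
    unfolding \<open>Y = span (insert utilde (\<xi> ` {1..L}))\<close> by (rule span_base) simp

  have "?d - y\<^sub>\<xi> = \<epsilon> *\<^sub>R utilde - uloc"
    by (simp add: \<open>uY = (1 + \<epsilon>) *\<^sub>R utilde + y\<^sub>\<xi>\<close> \<open>utilde = uW - uloc\<close> algebra_simps)
  moreover have "\<epsilon> *\<^sub>R utilde - uloc \<in> W"
    using uloc utilde_W unfolding \<open>W = span (\<phi> ` {1..N})\<close> by (intro span_diff span_scale)
  ultimately have W: "residual a b uW ?d = residual a b uW y\<^sub>\<xi>"
    by (intro residual_eq_modulo_trial_space[OF bil lin \<open>variational_solution a b W uW\<close>]) (simp only:)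

  have "?d - (- uloc) = uY - utilde"
    by (simp add: \<open>utilde = uW - uloc\<close>)
  moreover have "uY - utilde \<in> Y"
    using uY utilde_Y unfolding \<open>Y = span (insert utilde (\<xi> ` {1..L}))\<close> by (rule span_diff)
  ultimately have "residual a b uY ?d = residual a b uY (- uloc)"
    by (intro residual_eq_modulo_trial_space[OF bil lin \<open>variational_solution a b Y uY\<close>]) (simp only:)
  then have Y: "residual a b uY ?d = - residual a b uY uloc"
    by (simp add: linear_neg[OF linear_residual[OF bil lin]])

  have "error_reduction a uX uW uY = residual a b uW ?d + residual a b uY ?d"
    using bil \<open>symmetric_form a\<close> \<open>coercive_form a\<close> \<open>variational_solution a b UNIV uX\<close>
    by (rule error_reduction_eq_residuals)
  moreover have "(energy_norm a ?d)\<^sup>2 = residual a b uW ?d - residual a b uY ?d"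
    using bil \<open>coercive_form a\<close> by (rule energy_norm_diff_eq_residuals)
  ultimately show ?thesis
    by (simp add: W Y)
qed

end
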